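(* Let $w$ be the weight on $\mathbb{R}_+=(0,\infty)$ described in the context, let $\mathcal{H}=L^2(\mathbb{R}_+,w(T)\,\mathrm{d}T)$, let $H_0$ be the operator with domain $C_c^\infty(0,\infty)\subset\mathcal{H}$ given by $(H_0 f)(T)=-i\left(\frac{\mathrm{d}}{\mathrm{d}T}+\frac12\frac{w'(T)}{w(T)}\right)f(T)$, and let $\overline{H_0}$ be its closure. For every $\alpha\in\mathbb{R}$ and every bounded self-adjoint operator $V$ on $\mathcal{H}$, the operator $\mathcal{O}_\alpha=\overline{H_0}+\alpha V$ with domain $\mathcal{D}(\overline{H_0})$ is unbounded on $\mathcal{H}$, i.e. there is no constant $C$ such that $\|\mathcal{O}_\alpha f\|_{\mathcal{H}}\le C\|f\|_{\mathcal{H}}$ for all $f\in\mathcal{D}(\overline{H_0})$.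
   Context: The weight $w$ is the local density of nontrivial zeros of the Riemann zeta function, $w(T)=\frac{\mathrm{d}N}{\mathrm{d}T}(T)=\frac{1}{2\pi}\log\left(\frac{T}{2\pi}\right)+O(1)$, where $N(T)=\frac{T}{2\pi}\log\left(\frac{T}{2\pi}\right)-\frac{T}{2\pi}+\frac78+R(T)$, $R(T)=O(\log T)$, is the Riemann--von Mangoldt counting function. It is understood as a smooth, strictly positive function $w:(0,\infty)\to(0,\infty)$ with $w(T)=\frac{1}{2\pi}\log\left(\frac{T}{2\pi}\right)+O(1)$ as $T\to\infty$. The Hilbert space $\mathcal{H}=L^2(\mathbb{R}_+,w(T)\,\mathrm{d}T)$ has inner product $\langle f,g\rangle_{\mathcal{H}}=\int_0^\infty f(T)\,\overline{g(T)}\,w(T)\,\mathrm{d}T$. $C_c^\infty(0,\infty)$ denotes the complex-valued smooth functions with compact support in $(0,\infty)$. *)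

theory Defs
  imports "HOL-Analysis.Analysis" "HOL-Library.Landau_Symbols"
begin

text \<open>Used only for open \<open>S\<close>; \<open>D n\<close> is the \<open>n\<close>-th derivative on \<open>S\<close>.\<close>
definition smooth_on :: "real set \<Rightarrow> (real \<Rightarrow> 'a::real_normed_vector) \<Rightarrow> bool" where
  "smooth_on S f \<longleftrightarrow>
     (\<exists>D. D 0 = f \<and>
          (\<forall>n. \<forall>x\<in>S. (D n has_vector_derivative D (Suc n) x) (at x)))"

text \<open>The half-line \<open>{0<..}\<close> carries the weight; values of \<open>w\<close> elsewhere are irrelevant.\<close>
definition zero_density_weight :: "(real \<Rightarrow> real) \<Rightarrow> bool" where
  "zero_density_weight w \<longleftrightarrow>
     smooth_on {0<..} w \<and>
     (\<forall>T>0. w T > 0) \<and>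
     (\<lambda>T. w T - 1 / (2 * pi) * ln (T / (2 * pi))) \<in> O[at_top](\<lambda>_. 1)"

definition weight_measure :: "(real \<Rightarrow> real) \<Rightarrow> real measure" where
  "weight_measure w = density (restrict_space lborel {0<..}) (\<lambda>T. ennreal (w T))"

text \<open>
  Elements of the Hilbert space \<open>\<H>\<close> are represented by square-integrable functions;
  equality in \<open>\<H>\<close> is equality almost everywhere with respect to \<open>weight_measure w\<close>.
\<close>
definition L2 :: "(real \<Rightarrow> real) \<Rightarrow> (real \<Rightarrow> complex) set" where
  "L2 w = {f \<in> borel_measurable (weight_measure w).
             integrable (weight_measure w) (\<lambda>T. (cmod (f T))\<^sup>2)}"

definition L2_inner :: "(real \<Rightarrow> real) \<Rightarrow> (real \<Rightarrow> complex) \<Rightarrow> (real \<Rightarrow> complex) \<Rightarrow> complex" where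
  "L2_inner w f g = (LINT T|weight_measure w. f T * cnj (g T))"

definition L2_norm :: "(real \<Rightarrow> real) \<Rightarrow> (real \<Rightarrow> complex) \<Rightarrow> real" where
  "L2_norm w f = sqrt (LINT T|weight_measure w. (cmod (f T))\<^sup>2)"

text \<open>Members are extended by \<open>0\<close> to all of \<open>\<real>\<close>.\<close>
definition Cc_smooth :: "(real \<Rightarrow> complex) set" where
  "Cc_smooth = {f. smooth_on {0<..} f \<and>
                   compact (closure {x. f x \<noteq> 0}) \<and> closure {x. f x \<noteq> 0} \<subseteq> {0<..}}"

definition H0 :: "(real \<Rightarrow> real) \<Rightarrow> (real \<Rightarrow> complex) \<Rightarrow> (real \<Rightarrow> complex)" where
  "H0 w f = (\<lambda>T. - \<i> * (vector_derivative f (at T)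
                         + complex_of_real (1 / 2 * (deriv w T / w T)) * f T))"

text \<open>
  The closure, in \<open>\<H> \<times> \<H>\<close>, of the graph of \<open>H0\<close> on \<open>Cc_smooth\<close>.
  \<open>H0\<close> is symmetric, hence closable, so this is again the graph of an operator:
  its second component is determined almost everywhere by the first.
\<close>
definition H0_closure_graph ::
    "(real \<Rightarrow> real) \<Rightarrow> ((real \<Rightarrow> complex) \<times> (real \<Rightarrow> complex)) set" where
  "H0_closure_graph w =
     {(f, g). f \<in> L2 w \<and> g \<in> L2 w \<and>
        (\<exists>\<phi>. (\<forall>n::nat. \<phi> n \<in> Cc_smooth) \<and>
             (\<lambda>n. L2_norm w (\<lambda>T. \<phi> n T - f T)) \<longlonglongrightarrow> 0 \<and>
             (\<lambda>n. L2_norm w (\<lambda>T. H0 w (\<phi> n) T - g T)) \<longlonglongrightarrow> 0)}"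

definition H0_closure_dom :: "(real \<Rightarrow> real) \<Rightarrow> (real \<Rightarrow> complex) set" where
  "H0_closure_dom w = Domain (H0_closure_graph w)"

text \<open>The choice operator only picks a representative of the a.e.-unique value.\<close>
definition H0_closure :: "(real \<Rightarrow> real) \<Rightarrow> (real \<Rightarrow> complex) \<Rightarrow> (real \<Rightarrow> complex)" where
  "H0_closure w f = (SOME g. (f, g) \<in> H0_closure_graph w)"

text \<open>
  Linearity and boundedness together imply that \<open>V\<close> respects equality almost everywhere.
  As \<open>V\<close> is bounded and everywhere defined, \<open>V = V*\<close> means that \<open>V\<close> may be moved
  across the inner product.
\<close>
definition bounded_selfadjoint ::
    "(real \<Rightarrow> real) \<Rightarrow> ((real \<Rightarrow> complex) \<Rightarrow> (real \<Rightarrow> complex)) \<Rightarrow> bool" where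
  "bounded_selfadjoint w V \<longleftrightarrow>
     (\<forall>f\<in>L2 w. V f \<in> L2 w) \<and>
     (\<forall>f\<in>L2 w. \<forall>g\<in>L2 w.
        AE T in weight_measure w. V (\<lambda>x. f x + g x) T = V f T + V g T) \<and>
     (\<forall>c. \<forall>f\<in>L2 w. AE T in weight_measure w. V (\<lambda>x. c * f x) T = c * V f T) \<and>
     (\<exists>K. \<forall>f\<in>L2 w. L2_norm w (V f) \<le> K * L2_norm w f) \<and>
     (\<forall>f\<in>L2 w. \<forall>g\<in>L2 w. L2_inner w (V f) g = L2_inner w f (V g))"

definition perturbed_op ::
    "(real \<Rightarrow> real) \<Rightarrow> real \<Rightarrow> ((real \<Rightarrow> complex) \<Rightarrow> (real \<Rightarrow> complex)) \<Rightarrow>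
     (real \<Rightarrow> complex) \<Rightarrow> (real \<Rightarrow> complex)" where
  "perturbed_op w \<alpha> V f = (\<lambda>T. H0_closure w f T + complex_of_real \<alpha> * V f T)"

end

theory Submission
  imports Defs
begin

text \<open>
  \<open>H0\<close> is a momentum operator: up to conjugation with $\sqrt w$ it is $-i\,\mathrm{d}/\mathrm{d}T$, so it
  multiplies the norm of a rapidly oscillating function by roughly the frequency of oscillation.
  A bounded perturbation cannot cancel this.

  For the proof let $f_l = u\,e^{ilT}$ with a fixed smooth real bump $u$ supported in $[1,2]$. The norm
  of $f_l$ does not depend on $l$, and $\mathrm{Re}\langle f_l, H_0 f_l\rangle = l\,\|f_l\|^2$
  (\<open>Re_L2_inner_H0_bump_wave\<close>). The value $g$ of the closure at $f_l$ is some
  representative, known only as a limit of $H_0\varphi_n$ along test functions $\varphi_n \to f_l$.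
  Only the number $\langle g, f_l\rangle$ is needed, and by symmetry of \<open>H0\<close> (\<open>H0_symmetric\<close>) it
  is the limit of $\langle H_0\varphi_n, f_l\rangle = \langle \varphi_n, H_0 f_l\rangle$, namely
  $\langle f_l, H_0 f_l\rangle$ (\<open>H0_closure_graph_weak\<close>).

  If the perturbed operator were bounded by $C$ and $V$ by $K$, the Cauchy--Schwarz inequality would
  give $l\,\|f_l\|^2 \le |\langle g, f_l\rangle| \le (C + |\alpha| K)\,\|f_l\|^2$ for every $l$, which
  is false for $l = C + |\alpha| K + 1$ since $\|f_l\| > 0$ (\<open>L2_norm_pos\<close>).
\<close>

section \<open>Smooth bumps modulated by waves\<close>

text \<open>
A class of functions closed under taking derivatives consists of smooth functions:
iterating a choice of derivative inside the class yields the required sequence.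
\<close>

lemma smooth_on_coinduct:
  assumes "f \<in> F"
    and "\<And>g. g \<in> F \<Longrightarrow> \<exists>g'\<in>F. \<forall>x\<in>S. (g has_vector_derivative g' x) (at x)"
  shows "smooth_on S f"
proof -
  obtain d where d: "\<And>g. g \<in> F \<Longrightarrow> d g \<in> F \<and> (\<forall>x\<in>S. (g has_vector_derivative d g x) (at x))"
    using assms(2) by metis
  have "(d ^^ n) f \<in> F" for n
    by (induction n) (auto simp: assms(1) d)
  then show ?thesis
    unfolding smooth_on_def by (intro exI[of _ "\<lambda>n. (d ^^ n) f"]) (use d in auto)
qed

lemma smooth_onE:
  assumes "smooth_on S f"
  obtains f' where "\<And>x. x \<in> S \<Longrightarrow> (f has_vector_derivative f' x) (at x)" "continuous_on S f'"
proof -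
  obtain D where D: "D 0 = f" "\<And>n x. x \<in> S \<Longrightarrow> (D n has_vector_derivative D (Suc n) x) (at x)"
    using assms unfolding smooth_on_def by blast
  have "continuous_on S (D 1)"
    using D(2)[of _ 1] by (intro continuous_at_imp_continuous_on ballI has_vector_derivative_continuous) auto
  moreover have "(f has_vector_derivative D 1 x) (at x)" if "x \<in> S" for x
    using D(2)[OF that, of 0] D(1) by simp
  ultimately show thesis using that by blast
qed

text \<open>
The flat functions $p(1/x)\,e^{-1/x}$, continued by $0$ to $x \le 0$. The polynomial factor
makes the family closed under differentiation, which plain $e^{-1/x}$ is not.
\<close>

definition flat :: "real poly \<Rightarrow> real \<Rightarrow> real" where
  "flat p x = (if x > 0 then poly p (1 / x) * exp (- (1 / x)) else 0)"

lemma poly_times_exp_minus_tendsto_0: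
  "((\<lambda>y::real. poly p y * exp (- y)) \<longlongrightarrow> 0) at_top"
proof -
  have "((\<lambda>y. \<Sum>i\<le>degree p. coeff p i * (y ^ i / exp y)) \<longlongrightarrow> (\<Sum>i\<le>degree p. coeff p i * 0)) at_top"
    by (intro tendsto_intros tendsto_power_div_exp_0)
  then show ?thesis
    by (simp add: poly_altdef sum_distrib_right exp_minus divide_inverse mult.assoc)
qed

text \<open>
Away from the origin this is the chain rule: $\frac{\mathrm{d}}{\mathrm{d}x}p(1/x)e^{-1/x} = y^2(p(y)-p'(y))e^{-y}$
with $y = 1/x$. At the origin the right difference quotient is $y\,p(y)\,e^{-y}$, which vanishes as
$y \to \infty$ because the exponential beats every polynomial.
\<close>

lemma has_real_derivative_flat:
  "(flat p has_real_derivative flat (monom 1 2 * (p - pderiv p)) x) (at x)"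
proof -
  consider "x > 0" | "x < 0" | "x = 0" by linarith
  then show ?thesis
  proof cases
    case 1
    have "((\<lambda>x. poly p (1 / x) * exp (- (1 / x))) has_real_derivative
             flat (monom 1 2 * (p - pderiv p)) x) (at x)"
      using 1 by (auto intro!: derivative_eq_intros
          simp: flat_def poly_monom field_simps power2_eq_square)
    then show ?thesis
      by (rule has_field_derivative_transform_within_open[of _ _ _ "{0<..}"]) (use 1 in \<open>auto simp: flat_def\<close>)
  next
    case 2
    have "((\<lambda>x. 0) has_real_derivative 0) (at x)" by simp
    then have "(flat p has_real_derivative 0) (at x)"
      by (rule has_field_derivative_transform_within_open[of _ _ _ "{..<0}"]) (use 2 in \<open>auto simp: flat_def\<close>)
    then show ?thesis using 2 by (simp add: flat_def)
  next
    case 3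
    have "((\<lambda>h. flat p h / h) \<longlongrightarrow> 0) (at 0)"
    proof (rule filterlim_split_at)
      have "((\<lambda>_. 0) \<longlongrightarrow> (0::real)) (at_left 0)" by simp
      then show "((\<lambda>h. flat p h / h) \<longlongrightarrow> 0) (at_left 0)"
        by (rule Lim_transform_eventually)
          (simp add: flat_def eventually_at_filter)
      have "((\<lambda>h. poly (pCons 0 p) (inverse h) * exp (- inverse h)) \<longlongrightarrow> (0::real)) (at_right 0)"
        by (rule filterlim_compose[OF poly_times_exp_minus_tendsto_0 filterlim_inverse_at_top_right])
      then show "((\<lambda>h. flat p h / h) \<longlongrightarrow> 0) (at_right 0)"
        by (rule Lim_transform_eventually)
          (simp add: flat_def eventually_at_filter divide_inverse mult_ac)
    qed
    then show ?thesis using 3 by (simp add: has_field_derivative_iff flat_def)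
  qed
qed

text \<open>
A class of functions closed under differentiation that contains all the test functions used
below. The shifts by $1$ and $2$ fix the support of the bump to be $[1,2]$.
\<close>

inductive_set flat_wave_algebra :: "(real \<Rightarrow> complex) set" where
  flat_left: "(\<lambda>x. of_real (flat p (x - 1))) \<in> flat_wave_algebra"
| flat_right: "(\<lambda>x. of_real (flat p (2 - x))) \<in> flat_wave_algebra"
| wave: "(\<lambda>x. c * cis (l * x)) \<in> flat_wave_algebra"
| add: "f \<in> flat_wave_algebra \<Longrightarrow> g \<in> flat_wave_algebra \<Longrightarrow> (\<lambda>x. f x + g x) \<in> flat_wave_algebra"
| mult: "f \<in> flat_wave_algebra \<Longrightarrow> g \<in> flat_wave_algebra \<Longrightarrow> (\<lambda>x. f x * g x) \<in> flat_wave_algebra"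

lemma has_vector_derivative_cis_linear:
  "((\<lambda>x. c * cis (l * x)) has_vector_derivative c * \<i> * of_real l * cis (l * x)) (at x)"
proof -
  have "((\<lambda>x. exp (\<i> * of_real l * of_real x)) has_vector_derivative exp (\<i> * of_real l * of_real x) * (\<i> * of_real l)) (at x)"
    by (auto intro!: derivative_eq_intros has_vector_derivative_real_field)
  from has_vector_derivative_mult_right[OF this, of c] show ?thesis
    by (simp add: cis_conv_exp mult_ac)
qed

lemma flat_wave_algebra_derivative:
  assumes "f \<in> flat_wave_algebra"
  shows "\<exists>f'\<in>flat_wave_algebra. \<forall>x. (f has_vector_derivative f' x) (at x)"
  using assms
proof induction
  case (flat_left p)
  have "((\<lambda>x. flat p (x - 1)) has_real_derivative flat (monom 1 2 * (p - pderiv p)) (x - 1)) (at x)" for x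
  proof -
    have "((\<lambda>x. flat p (x - 1)) has_real_derivative flat (monom 1 2 * (p - pderiv p)) (x - 1) * 1) (at x)"
      by (rule DERIV_chain2[OF has_real_derivative_flat]) (auto intro!: derivative_eq_intros)
    then show ?thesis by simp
  qed
  then show ?case
    by (intro bexI[OF _ flat_wave_algebra.flat_left] allI has_vector_derivative_of_real)
next
  case (flat_right p)
  have "((\<lambda>x. flat p (2 - x)) has_real_derivative flat (- (monom 1 2 * (p - pderiv p))) (2 - x)) (at x)" for x
  proof -
    have "((\<lambda>x. flat p (2 - x)) has_real_derivative flat (monom 1 2 * (p - pderiv p)) (2 - x) * - 1) (at x)"
      by (rule DERIV_chain2[OF has_real_derivative_flat]) (auto intro!: derivative_eq_intros)
    moreover have "flat (monom 1 2 * (p - pderiv p)) (2 - x) * - 1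
        = flat (- (monom 1 2 * (p - pderiv p))) (2 - x)"
      by (simp add: flat_def)
    ultimately show ?thesis by metis
  qed
  then show ?case
    by (intro bexI[OF _ flat_wave_algebra.flat_right] allI has_vector_derivative_of_real)
next
  case (wave c l)
  show ?case
    by (rule bexI[OF _ flat_wave_algebra.wave]) (use has_vector_derivative_cis_linear in blast)
next
  case (add f g)
  then obtain f' g' where "f' \<in> flat_wave_algebra" "g' \<in> flat_wave_algebra"
    "\<And>x. (f has_vector_derivative f' x) (at x)" "\<And>x. (g has_vector_derivative g' x) (at x)" by blast
  then show ?case
    by (intro bexI[of _ "\<lambda>x. f' x + g' x"] allI has_vector_derivative_add flat_wave_algebra.add)
next
  case (mult f g)
  then obtain f' g' where "f' \<in> flat_wave_algebra" "g' \<in> flat_wave_algebra"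
    "\<And>x. (f has_vector_derivative f' x) (at x)" "\<And>x. (g has_vector_derivative g' x) (at x)" by blast
  with mult.hyps show ?case
    by (intro bexI[of _ "\<lambda>x. f x * g' x + f' x * g x"] allI has_vector_derivative_mult
        flat_wave_algebra.add flat_wave_algebra.mult)
qed

definition bump :: "real \<Rightarrow> real" where
  "bump x = flat 1 (x - 1) * flat 1 (2 - x)"

lemma bump_eq_0_iff: "bump x = 0 \<longleftrightarrow> x \<notin> {1<..<2}"
  by (auto simp: bump_def flat_def)

lemma bump_wave_Cc_smooth: "(\<lambda>x. of_real (bump x) * cis (l * x)) \<in> Cc_smooth"
proof -
  have "(\<lambda>x. of_real (bump x) * (1 * cis (l * x))) \<in> flat_wave_algebra"
    unfolding bump_def of_real_mult by (intro flat_wave_algebra.intros)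
  then have "smooth_on {0<..} (\<lambda>x. of_real (bump x) * (1 * cis (l * x)))"
    by (rule smooth_on_coinduct) (use flat_wave_algebra_derivative in blast)
  then have smooth: "smooth_on {0<..} (\<lambda>x. of_real (bump x) * cis (l * x))"
    by (simp only: mult_1)
  have "{x. of_real (bump x) * cis (l * x) \<noteq> 0} = {1<..<2}"
    by (auto simp: bump_eq_0_iff)
  then have support: "closure {x. of_real (bump x) * cis (l * x) \<noteq> 0} = {1..2}"
    by (simp only: closure_greaterThanLessThan[of "1::real" 2])
  show ?thesis
    unfolding Cc_smooth_def mem_Collect_eq support using smooth by (intro conjI) auto
qed

lemma bump_differentiable:
  obtains u' where "(bump has_real_derivative u') (at x)"
proof -
  have "((\<lambda>x. flat 1 (x - 1) * flat 1 (2 - x)) has_real_derivative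
      flat (monom 1 2 * (1 - pderiv 1)) (x - 1) * 1 * flat 1 (2 - x) +
      flat (monom 1 2 * (1 - pderiv 1)) (2 - x) * -1 * flat 1 (x - 1)) (at x)"
    by (intro DERIV_mult DERIV_chain2[OF has_real_derivative_flat]) (auto intro!: derivative_eq_intros)
  then show ?thesis using that unfolding bump_def[abs_def] by blast
qed

section \<open>The Cauchy--Schwarz inequality\<close>

lemma square_integrable_times_cnj:
  fixes f g :: "'a \<Rightarrow> complex"
  assumes [measurable]: "f \<in> borel_measurable M" "g \<in> borel_measurable M"
    and f: "integrable M (\<lambda>x. (cmod (f x))\<^sup>2)" and g: "integrable M (\<lambda>x. (cmod (g x))\<^sup>2)"
  shows "integrable M (\<lambda>x. f x * cnj (g x))"
proof (rule Bochner_Integration.integrable_bound[OF Bochner_Integration.integrable_add[OF f g]])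
  have "a * b \<le> a\<^sup>2 + b\<^sup>2" if "a \<ge> 0" "b \<ge> 0" for a b :: real
    using sum_squares_bound[of a b] that mult_nonneg_nonneg[of a b] by linarith
  then show "AE x in M. norm (f x * cnj (g x)) \<le> norm ((cmod (f x))\<^sup>2 + (cmod (g x))\<^sup>2)"
    by (auto simp: norm_mult)
  have "(\<lambda>x. cnj (g x)) \<in> borel_measurable M"
    by (rule borel_measurable_continuous_on[where f = cnj]) (auto intro!: continuous_intros)
  then show "(\<lambda>x. f x * cnj (g x)) \<in> borel_measurable M" by simp
qed

text \<open>
The usual argument: $\int (|f| - t|g|)^2 \ge 0$ for every real $t$, so this quadratic polynomial
in $t$ has no positive discriminant.
\<close>

lemma Cauchy_Schwarz_integral:
  fixes f g :: "'a \<Rightarrow> complex"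
  assumes [measurable]: "f \<in> borel_measurable M" "g \<in> borel_measurable M"
    and f: "integrable M (\<lambda>x. (cmod (f x))\<^sup>2)" and g: "integrable M (\<lambda>x. (cmod (g x))\<^sup>2)"
  shows "cmod (LINT x|M. f x * cnj (g x))
           \<le> sqrt (LINT x|M. (cmod (f x))\<^sup>2) * sqrt (LINT x|M. (cmod (g x))\<^sup>2)"
proof -
  define A B I where "A = (LINT x|M. (cmod (f x))\<^sup>2)" and "B = (LINT x|M. (cmod (g x))\<^sup>2)"
    and "I = (LINT x|M. cmod (f x) * cmod (g x))"
  have int: "integrable M (\<lambda>x. cmod (f x) * cmod (g x))"
    using integrable_norm[OF square_integrable_times_cnj[OF assms]] by (simp add: norm_mult)
  have quadratic: "0 \<le> A - 2 * t * I + t\<^sup>2 * B" for t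
  proof -
    have "0 \<le> (LINT x|M. (cmod (f x) - t * cmod (g x))\<^sup>2)"
      by simp
    also have "\<dots> = (LINT x|M. (cmod (f x))\<^sup>2 - 2 * t * (cmod (f x) * cmod (g x)) + t\<^sup>2 * (cmod (g x))\<^sup>2)"
      by (simp add: power2_eq_square algebra_simps)
    also have "\<dots> = A - 2 * t * I + t\<^sup>2 * B"
      using f g int by (simp add: A_def B_def I_def)
    finally show ?thesis .
  qed
  have nonneg: "A \<ge> 0" "B \<ge> 0" "I \<ge> 0"
    by (auto simp: A_def B_def I_def intro!: integral_nonneg_AE)
  have "I\<^sup>2 \<le> A * B"
  proof (cases "B = 0")
    case True
    have "I = 0"
    proof (rule ccontr)
      assume "I \<noteq> 0"
      \<comment> \<open>Without its quadratic term the polynomial is linear in \<open>t\<close>; at this \<open>t\<close> it equals \<open>-1\<close>.\<close>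
      with quadratic[of "(A + 1) / (2 * I)"] True nonneg show False
        by (simp add: field_simps)
    qed
    then show ?thesis using True by simp
  next
    case False
    \<comment> \<open>The minimum of the polynomial is attained at \<open>t = I / B\<close>.\<close>
    with quadratic[of "I / B"] nonneg show ?thesis
      by (simp add: field_simps power2_eq_square)
  qed
  then have "I \<le> sqrt A * sqrt B"
    by (simp add: real_le_rsqrt real_sqrt_mult[symmetric])
  moreover have "cmod (LINT x|M. f x * cnj (g x)) \<le> I"
    unfolding I_def using integral_norm_bound[of M "\<lambda>x. f x * cnj (g x)"] by (simp add: norm_mult)
  ultimately show ?thesis by (simp add: A_def B_def)
qed

lemma L2_inner_integrable:
  "f \<in> L2 w \<Longrightarrow> g \<in> L2 w \<Longrightarrow> integrable (weight_measure w) (\<lambda>T. f T * cnj (g T))"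
  by (simp add: L2_def square_integrable_times_cnj)

lemma L2_Cauchy_Schwarz:
  "f \<in> L2 w \<Longrightarrow> g \<in> L2 w \<Longrightarrow> cmod (L2_inner w f g) \<le> L2_norm w f * L2_norm w g"
  by (simp add: L2_def L2_inner_def L2_norm_def Cauchy_Schwarz_integral)

lemma L2_add:
  assumes "f \<in> L2 w" "g \<in> L2 w"
  shows "(\<lambda>T. f T + g T) \<in> L2 w"
proof -
  let ?M = "weight_measure w"
  have [measurable]: "f \<in> borel_measurable ?M" "g \<in> borel_measurable ?M"
    using assms by (auto simp: L2_def)
  have "integrable ?M (\<lambda>T. 2 * (cmod (f T))\<^sup>2 + 2 * (cmod (g T))\<^sup>2)"
    using assms by (auto simp: L2_def)
  then have "integrable ?M (\<lambda>T. (cmod (f T + g T))\<^sup>2)"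
  proof (rule Bochner_Integration.integrable_bound)
    have "(cmod (a + b))\<^sup>2 \<le> 2 * (cmod a)\<^sup>2 + 2 * (cmod b)\<^sup>2" for a b
    proof -
      have "(cmod (a + b))\<^sup>2 \<le> (cmod a + cmod b)\<^sup>2"
        by (simp add: norm_triangle_ineq power_mono)
      also have "\<dots> \<le> 2 * (cmod a)\<^sup>2 + 2 * (cmod b)\<^sup>2"
        using sum_squares_bound[of "cmod a" "cmod b"] by (simp add: power2_sum)
      finally show ?thesis .
    qed
    then show "AE T in ?M. norm ((cmod (f T + g T))\<^sup>2) \<le> norm (2 * (cmod (f T))\<^sup>2 + 2 * (cmod (g T))\<^sup>2)"
      by auto
  qed simp
  then show ?thesis by (simp add: L2_def)
qed

lemma L2_scale: "f \<in> L2 w \<Longrightarrow> (\<lambda>T. c * f T) \<in> L2 w"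
  by (auto simp: L2_def norm_mult power_mult_distrib)

lemma L2_diff: "f \<in> L2 w \<Longrightarrow> g \<in> L2 w \<Longrightarrow> (\<lambda>T. f T - g T) \<in> L2 w"
  using L2_add[OF _ L2_scale[of g w "-1"], of f] by simp

lemma L2_inner_tendsto:
  assumes "\<And>n. \<phi> n \<in> L2 w" "f \<in> L2 w" "g \<in> L2 w"
    and "(\<lambda>n. L2_norm w (\<lambda>T. \<phi> n T - f T)) \<longlonglongrightarrow> 0"
  shows "(\<lambda>n. L2_inner w (\<phi> n) g) \<longlonglongrightarrow> L2_inner w f g"
proof -
  have "(\<lambda>n. L2_inner w (\<phi> n) g - L2_inner w f g) \<longlonglongrightarrow> 0"
  proof (rule Lim_null_comparison)
    have "L2_inner w (\<phi> n) g - L2_inner w f g = L2_inner w (\<lambda>T. \<phi> n T - f T) g" for n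
      using assms by (simp add: L2_inner_def left_diff_distrib L2_inner_integrable)
    then show "\<forall>\<^sub>F n in sequentially. norm (L2_inner w (\<phi> n) g - L2_inner w f g)
                 \<le> L2_norm w (\<lambda>T. \<phi> n T - f T) * L2_norm w g"
      using assms by (auto intro!: always_eventually L2_Cauchy_Schwarz L2_diff)
    show "(\<lambda>n. L2_norm w (\<lambda>T. \<phi> n T - f T) * L2_norm w g) \<longlonglongrightarrow> 0"
      using tendsto_mult_left_zero[OF assms(4)] .
  qed
  then show ?thesis by (rule LIM_zero_cancel)
qed

section \<open>Integration of compactly supported functions against the weight\<close>

text \<open>
This turns integrals over the weighted half-line into ordinary integrals over a compact
interval, where the fundamental theorem of calculus applies. The support has to stay away
from the origin, where \<open>w\<close> may blow up.
\<close>

lemma weight_measure_integral: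
  fixes k :: "real \<Rightarrow> 'a::euclidean_space"
  assumes w: "continuous_on {0<..} w" "\<And>T. T > 0 \<Longrightarrow> w T > 0"
    and k: "continuous_on {0<..} k" and ab: "0 < a" "\<And>T. T > 0 \<Longrightarrow> T \<notin> {a..b} \<Longrightarrow> k T = 0"
  shows "k \<in> borel_measurable (weight_measure w)"
    and "integrable (weight_measure w) k"
    and "(LINT T|weight_measure w. k T) = integral {a..b} (\<lambda>T. w T *\<^sub>R k T)"
proof -
  let ?R = "restrict_space lborel {0::real<..}"
  have meas: "h \<in> borel_measurable ?R" if "continuous_on {0<..} h" for h :: "real \<Rightarrow> 'b::euclidean_space"
    using borel_measurable_continuous_on_restrict[OF that]
      measurable_cong_sets[OF sets_restrict_space_cong[OF sets_lborel] refl] by blast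
  have wk: "w \<in> borel_measurable ?R" "k \<in> borel_measurable ?R" by (auto intro: meas w k)
  have pos: "AE T in ?R. 0 \<le> w T"
    by (rule AE_I2) (use w(2) in \<open>auto simp: space_restrict_space less_imp_le\<close>)
  show "k \<in> borel_measurable (weight_measure w)"
    using wk by (simp add: weight_measure_def)
  have eq: "(\<lambda>T. indicator {0<..} T *\<^sub>R w T *\<^sub>R k T) = (\<lambda>T. indicator {a..b} T *\<^sub>R w T *\<^sub>R k T)"
    using ab by (force simp: indicator_def)
  have int: "integrable lborel (\<lambda>T. indicator {a..b} T *\<^sub>R w T *\<^sub>R k T)"
    by (rule borel_integrable_compact) (use ab in \<open>auto intro!: continuous_intros continuous_on_subset[OF w(1)] continuous_on_subset[OF k]\<close>)
  show "integrable (weight_measure w) k"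
    unfolding weight_measure_def
    by (simp add: integrable_density wk pos integrable_restrict_space eq int del: scaleR_scaleR)
  show "(LINT T|weight_measure w. k T) = integral {a..b} (\<lambda>T. w T *\<^sub>R k T)"
    unfolding weight_measure_def
    using set_borel_integral_eq_integral(2)[of "{a..b}" "\<lambda>T. w T *\<^sub>R k T"] int
    by (simp add: integral_density wk pos integral_restrict_space eq set_integrable_def set_lebesgue_integral_def
        del: scaleR_scaleR)
qed

section \<open>Symmetry of the operator and its closure\<close>

lemma zero_density_weightE:
  assumes "zero_density_weight w"
  obtains w' where "\<And>T. T > 0 \<Longrightarrow> (w has_real_derivative w' T) (at T)"
    "continuous_on {0<..} w'" "continuous_on {0<..} w" "\<And>T. T > 0 \<Longrightarrow> w T > 0"
proof -
  have "smooth_on {0<..} w" using assms by (simp add: zero_density_weight_def)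
  then obtain w' where w': "\<And>T. T \<in> {0<..} \<Longrightarrow> (w has_vector_derivative w' T) (at T)"
    "continuous_on {0<..} w'" by (rule smooth_onE) blast
  have "continuous_on {0<..} w"
    using w'(1) by (intro continuous_at_imp_continuous_on ballI has_vector_derivative_continuous)
  with w' assms show thesis
    by (intro that) (auto simp: zero_density_weight_def has_real_derivative_iff_has_vector_derivative)
qed

text \<open>
The support lies inside an interval larger than its convex hull, so that the
function vanishes at the endpoints and its derivative vanishes outside.
\<close>

lemma Cc_smoothE:
  assumes "f \<in> Cc_smooth"
  obtains f' a b where "0 < a" "a \<le> b" "f a = 0" "f b = 0"
    "\<And>T. T \<notin> {a..b} \<Longrightarrow> f T = 0" "\<And>T. T > 0 \<Longrightarrow> T \<notin> {a..b} \<Longrightarrow> f' T = 0"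
    "\<And>T. T > 0 \<Longrightarrow> (f has_vector_derivative f' T) (at T)"
    "continuous_on {0<..} f'" "continuous_on {0<..} f"
proof -
  let ?K = "closure {x. f x \<noteq> 0}"
  have f: "smooth_on {0<..} f" and K: "compact ?K" "?K \<subseteq> {0<..}"
    using assms by (auto simp: Cc_smooth_def)
  obtain f' where f': "\<And>T. T \<in> {0<..} \<Longrightarrow> (f has_vector_derivative f' T) (at T)"
    "continuous_on {0<..} f'" using f by (rule smooth_onE) blast
  obtain a b where ab: "0 < a" "a \<le> b" "?K \<subseteq> {a<..<b}"
  proof (cases "?K = {}")
    case True
    then show ?thesis using that[of 1 1] by simp
  next
    case False
    obtain s where s: "s \<in> ?K" "\<And>x. x \<in> ?K \<Longrightarrow> s \<le> x"
      using compact_attains_inf[OF K(1) False] by blast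
    obtain t where t: "t \<in> ?K" "\<And>x. x \<in> ?K \<Longrightarrow> x \<le> t"
      using compact_attains_sup[OF K(1) False] by blast
    have "s > 0" using s(1) K(2) by auto
    moreover have "s / 2 < x \<and> x < t + 1" if "x \<in> ?K" for x
      using s(2)[OF that] t(2)[OF that] \<open>s > 0\<close> by linarith
    moreover have "s / 2 \<le> t + 1" using calculation t(1) by force
    \<comment> \<open>Halving the infimum and enlarging the supremum keeps the interval inside the half-line.\<close>
    ultimately show ?thesis
      by (intro that[of "s / 2" "t + 1"]) auto
  qed
  have zero: "f T = 0" if "T \<notin> {a<..<b}" for T
    using that ab(3) closure_subset[of "{x. f x \<noteq> 0}"] by blast
  have "f' T = 0" if "T > 0" "T \<notin> {a..b}" for T
  proof -
    have "(f has_vector_derivative 0) (at T)"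
    proof (rule has_vector_derivative_transform_within_open)
      show "((\<lambda>_. 0) has_vector_derivative 0) (at T)" by (rule has_vector_derivative_const)
      show "open (- {a..b})" by (simp add: open_Compl)
      show "T \<in> - {a..b}" using that(2) by simp
      show "0 = f x" if "x \<in> - {a..b}" for x using zero[of x] that by auto
    qed
    then show ?thesis using f'(1)[of T] that vector_derivative_unique_at by auto
  qed
  moreover have "continuous_on {0<..} f"
    using f'(1) by (intro continuous_at_imp_continuous_on ballI has_vector_derivative_continuous)
  ultimately show thesis
    using f' ab zero by (intro that[of a b f']) auto
qed

lemma H0_eq:
  assumes "(w has_real_derivative w') (at T)" "(f has_vector_derivative f') (at T)"
  shows "H0 w f T = - \<i> * (f' + of_real (w' / (2 * w T)) * f T)"
  using DERIV_imp_deriv[OF assms(1)] vector_derivative_at[OF assms(2)] by (simp add: H0_def)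

lemma continuous_on_H0:
  assumes "zero_density_weight w" "f \<in> Cc_smooth"
  shows "continuous_on {0<..} (H0 w f)"
proof -
  obtain w' where w: "\<And>T. T > 0 \<Longrightarrow> (w has_real_derivative w' T) (at T)"
    "continuous_on {0<..} w'" "continuous_on {0<..} w" "\<And>T. T > 0 \<Longrightarrow> w T > 0"
    using assms(1) by (rule zero_density_weightE) blast
  obtain f' where f: "\<And>T. T > 0 \<Longrightarrow> (f has_vector_derivative f' T) (at T)"
    "continuous_on {0<..} f'" "continuous_on {0<..} f"
    using assms(2) by (rule Cc_smoothE) blast
  have "continuous_on {0<..} (\<lambda>T. - \<i> * (f' T + of_real (w' T / (2 * w T)) * f T))"
    using w(4) by (intro continuous_intros w f) (auto simp: less_imp_neq[THEN not_sym])
  then show ?thesis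
    by (rule continuous_on_eq) (use H0_eq[OF w(1) f(1)] in simp)
qed

lemma continuous_compact_support_L2:
  assumes w: "zero_density_weight w" and f: "continuous_on {0<..} f"
    and ab: "0 < a" "\<And>T. T > 0 \<Longrightarrow> T \<notin> {a..b} \<Longrightarrow> f T = 0"
  shows "f \<in> L2 w"
proof -
  obtain cont_w: "continuous_on {0<..} w" and pos_w: "\<And>T. T > 0 \<Longrightarrow> w T > 0"
    using w by (rule zero_density_weightE) blast
  have "f \<in> borel_measurable (weight_measure w)"
    by (rule weight_measure_integral(1)[OF cont_w pos_w f ab])
  moreover have "integrable (weight_measure w) (\<lambda>T. (cmod (f T))\<^sup>2)"
    by (rule weight_measure_integral(2)[OF cont_w pos_w _ ab(1)])
      (use f ab(2) in \<open>auto intro!: continuous_intros\<close>)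
  ultimately show ?thesis by (simp add: L2_def)
qed

lemma Cc_smooth_L2:
  assumes "zero_density_weight w" "f \<in> Cc_smooth"
  shows "f \<in> L2 w" and "H0 w f \<in> L2 w"
proof -
  obtain w' where w: "\<And>T. T > 0 \<Longrightarrow> (w has_real_derivative w' T) (at T)"
    using assms(1) by (rule zero_density_weightE) blast
  obtain a b f' where f: "0 < a" "\<And>T. T \<notin> {a..b} \<Longrightarrow> f T = 0"
    "\<And>T. T > 0 \<Longrightarrow> T \<notin> {a..b} \<Longrightarrow> f' T = 0"
    "\<And>T. T > 0 \<Longrightarrow> (f has_vector_derivative f' T) (at T)" "continuous_on {0<..} f"
    using assms(2) by (rule Cc_smoothE) blast
  show "f \<in> L2 w"
    using continuous_compact_support_L2[OF assms(1) f(5,1,2)] by blast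
  have "H0 w f T = 0" if "T > 0" "T \<notin> {a..b}" for T
    using H0_eq[OF w f(4)] f(2,3) that by simp
  then show "H0 w f \<in> L2 w"
    using continuous_compact_support_L2[OF assms(1) continuous_on_H0[OF assms] f(1)] by blast
qed

text \<open>
The term $\frac12 w'/w$ in \<open>H0\<close> is chosen exactly so that
$\bigl((H_0 f)\,\overline g - f\,\overline{H_0 g}\bigr)\,w = \frac{\mathrm{d}}{\mathrm{d}T}\bigl(-i\,w f \overline g\bigr)$,
and the integral of this derivative vanishes since $f$ is compactly supported.
\<close>

lemma H0_symmetric:
  assumes w: "zero_density_weight w" and f: "f \<in> Cc_smooth" and g: "g \<in> Cc_smooth"
  shows "L2_inner w (H0 w f) g = L2_inner w f (H0 w g)"
proof -
  note L2 = Cc_smooth_L2[OF w]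
  obtain w' where w': "\<And>T. T > 0 \<Longrightarrow> (w has_real_derivative w' T) (at T)"
    "continuous_on {0<..} w" "\<And>T. T > 0 \<Longrightarrow> w T > 0"
    using w by (rule zero_density_weightE) blast
  obtain a b f' where f': "0 < a" "a \<le> b" "f a = 0" "f b = 0" "\<And>T. T \<notin> {a..b} \<Longrightarrow> f T = 0"
    "\<And>T. T > 0 \<Longrightarrow> T \<notin> {a..b} \<Longrightarrow> f' T = 0"
    "\<And>T. T > 0 \<Longrightarrow> (f has_vector_derivative f' T) (at T)" "continuous_on {0<..} f"
    using f by (rule Cc_smoothE) blast
  obtain g' where g': "\<And>T. T > 0 \<Longrightarrow> (g has_vector_derivative g' T) (at T)" "continuous_on {0<..} g"
    using g by (rule Cc_smoothE) blast
  define k where "k T = H0 w f T * cnj (g T) - f T * cnj (H0 w g T)" for T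
  define F where "F T = - \<i> * (of_real (w T) * (f T * cnj (g T)))" for T
  have k: "continuous_on {0<..} k"
    unfolding k_def by (intro continuous_intros continuous_on_H0 w f g f' g')
  have k0: "k T = 0" if "T > 0" "T \<notin> {a..b}" for T
    using H0_eq[OF w'(1) f'(7)] f'(5,6) that by (simp add: k_def)
  have F: "(F has_vector_derivative w T *\<^sub>R k T) (at T)" if "T > 0" for T
  proof -
    have "(F has_vector_derivative - \<i> * (of_real (w T) * (f T * cnj (g' T) + f' T * cnj (g T))
            + of_real (w' T) * (f T * cnj (g T)))) (at T)"
      unfolding F_def
      by (intro has_vector_derivative_mult_right has_vector_derivative_mult has_vector_derivative_of_real
          w'(1) f'(7) g'(1) has_vector_derivative_cnj that)
    moreover have "- \<i> * (of_real (w T) * (f T * cnj (g' T) + f' T * cnj (g T))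
            + of_real (w' T) * (f T * cnj (g T))) = w T *\<^sub>R k T"
      using w'(3)[OF that]
      by (simp add: k_def H0_eq[OF w'(1) f'(7)] H0_eq[OF w'(1) g'(1)] that scaleR_conv_of_real field_simps)
    ultimately show ?thesis by simp
  qed
  have "L2_inner w (H0 w f) g - L2_inner w f (H0 w g) = (LINT T|weight_measure w. k T)"
    unfolding L2_inner_def k_def
    by (intro Bochner_Integration.integral_diff[symmetric] L2_inner_integrable L2 f g)
  also have "\<dots> = integral {a..b} (\<lambda>T. w T *\<^sub>R k T)"
    using weight_measure_integral(3)[OF w'(2,3) k f'(1) k0] by blast
  also have "\<dots> = F b - F a"
    using f'(1,2) by (intro integral_unique fundamental_theorem_of_calculus)
      (auto intro!: has_vector_derivative_at_within F)
  also have "\<dots> = 0" using f'(3,4) by (simp add: F_def)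
  finally show ?thesis by simp
qed

text \<open>
Symmetry survives the passage to the limit, since the inner product is continuous in its first
argument. This determines the inner products of a value of the closure with test functions,
whichever representative of that value is chosen.
\<close>

lemma H0_closure_graph_weak:
  assumes w: "zero_density_weight w" and fg: "(f, g) \<in> H0_closure_graph w" and h: "h \<in> Cc_smooth"
  shows "L2_inner w g h = L2_inner w f (H0 w h)"
proof -
  note L2 = Cc_smooth_L2[OF w]
  obtain \<phi> where \<phi>: "f \<in> L2 w" "g \<in> L2 w" "\<And>n::nat. \<phi> n \<in> Cc_smooth"
      "(\<lambda>n. L2_norm w (\<lambda>T. \<phi> n T - f T)) \<longlonglongrightarrow> 0"
      "(\<lambda>n. L2_norm w (\<lambda>T. H0 w (\<phi> n) T - g T)) \<longlonglongrightarrow> 0"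
    using fg by (auto simp: H0_closure_graph_def)
  have "(\<lambda>n. L2_inner w (\<phi> n) (H0 w h)) \<longlonglongrightarrow> L2_inner w f (H0 w h)"
    using \<phi> L2[OF h] L2[OF \<phi>(3)] by (intro L2_inner_tendsto)
  moreover have "(\<lambda>n. L2_inner w (\<phi> n) (H0 w h)) \<longlonglongrightarrow> L2_inner w g h"
    unfolding H0_symmetric[OF w \<phi>(3) h, symmetric]
    using \<phi> L2[OF h] L2[OF \<phi>(3)] by (intro L2_inner_tendsto)
  ultimately show ?thesis by (rule LIMSEQ_unique[symmetric])
qed

lemma Cc_smooth_H0_closure_graph:
  assumes "zero_density_weight w" "f \<in> Cc_smooth"
  shows "(f, H0 w f) \<in> H0_closure_graph w"
  using assms Cc_smooth_L2[OF assms]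
  by (auto simp: H0_closure_graph_def L2_norm_def intro!: exI[of _ "\<lambda>_. f"])

section \<open>Unboundedness\<close>

text \<open>
With $f = u\,e^{ilT}$ and $u$ real, $f\,\overline{H_0 f} = l u^2 + i\,u\,(u' + \tfrac12 (w'/w) u)$. The real
part grows linearly with the frequency, while $|f| = u$ does not depend on it.
\<close>

lemma Re_L2_inner_H0_bump_wave:
  fixes l :: real
  defines "f \<equiv> \<lambda>T. of_real (bump T) * cis (l * T)"
  assumes w: "zero_density_weight w"
  shows "Re (L2_inner w f (H0 w f)) = l * (L2_norm w f)\<^sup>2"
proof -
  have f: "f \<in> Cc_smooth" unfolding f_def by (rule bump_wave_Cc_smooth)
  note L2 = Cc_smooth_L2[OF w f]
  obtain w' where w': "\<And>T. T > 0 \<Longrightarrow> (w has_real_derivative w' T) (at T)"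
    using w by (rule zero_density_weightE) blast
  have pointwise: "Re (f T * cnj (H0 w f T)) = l * (cmod (f T))\<^sup>2" if "T > 0" for T
  proof -
    obtain u' where u': "(bump has_real_derivative u') (at T)" by (rule bump_differentiable)
    have f': "(f has_vector_derivative of_real (bump T) * (\<i> * of_real l * cis (l * T)) + of_real u' * cis (l * T)) (at T)"
      unfolding f_def using has_vector_derivative_cis_linear[of 1 l T]
      by (intro has_vector_derivative_mult has_vector_derivative_of_real u') simp
    have "f T * cnj (H0 w f T) =
        cis (l * T) * cnj (cis (l * T)) * of_real (bump T) * (\<i> * of_real (u' + w' T / (2 * w T) * bump T) + of_real (l * bump T))"
      unfolding H0_eq[OF w'[OF that] f'] by (simp add: f_def algebra_simps)
    also have "cis (l * T) * cnj (cis (l * T)) = 1"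
      by (simp add: cis_cnj cis_mult)
    finally have product: "f T * cnj (H0 w f T) =
        1 * of_real (bump T) * (\<i> * of_real (u' + w' T / (2 * w T) * bump T) + of_real (l * bump T))" .
    show ?thesis
      unfolding product by (simp add: f_def norm_mult power2_eq_square)
  qed
  have sp: "T > 0" if "T \<in> space (weight_measure w)" for T
    using that by (simp add: weight_measure_def space_restrict_space)
  have "Re (L2_inner w f (H0 w f)) = (LINT T|weight_measure w. Re (f T * cnj (H0 w f T)))"
    unfolding L2_inner_def by (rule integral_Re[symmetric, OF L2_inner_integrable[OF L2]])
  also have "\<dots> = (LINT T|weight_measure w. l * (cmod (f T))\<^sup>2)"
    by (intro Bochner_Integration.integral_cong refl pointwise sp)
  also have "\<dots> = l * (L2_norm w f)\<^sup>2"
    by (simp add: L2_norm_def)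
  finally show ?thesis .
qed

text \<open>
A nonzero test function is not a null function: the integrand is continuous, nonnegative and
nonzero somewhere.
\<close>

lemma L2_norm_pos:
  assumes w: "zero_density_weight w" and f: "f \<in> Cc_smooth" "f x \<noteq> 0"
  shows "L2_norm w f > 0"
proof -
  obtain cont_w: "continuous_on {0<..} w" and pos_w: "\<And>T. T > 0 \<Longrightarrow> w T > 0"
    using w by (rule zero_density_weightE) blast
  obtain a b where f': "0 < a" "a \<le> b" "f a = 0" "f b = 0" "\<And>T. T \<notin> {a..b} \<Longrightarrow> f T = 0"
     "continuous_on {0<..} f"
    using f(1) by (rule Cc_smoothE) blast
  define k where "k T = (cmod (f T))\<^sup>2" for T
  have k: "continuous_on {0<..} k" "\<And>T. T \<notin> {a..b} \<Longrightarrow> k T = 0"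
    using f' by (auto simp: k_def intro!: continuous_intros)
  have x: "x \<in> {a..b}" using f(2) f'(5) by blast
  have "x \<noteq> a" using f(2) f'(3) by auto
  with x have "a < b" by auto
  have nonneg: "w T * k T \<ge> 0" if "T \<in> {a..b}" for T
    using pos_w[of T] f'(1) that by (simp add: k_def)
  have cont: "continuous_on {a..b} (\<lambda>T. w T * k T)"
    using f'(1) by (auto intro!: continuous_intros continuous_on_subset[OF cont_w] continuous_on_subset[OF k(1)])
  have "w x * k x \<noteq> 0" using pos_w[of x] f(2) x f'(1) by (auto simp: k_def)
  then have "integral {a..b} (\<lambda>T. w T * k T) \<noteq> 0"
    using integral_eq_0_iff[OF cont \<open>a < b\<close> nonneg] x by blast
  moreover have "integral {a..b} (\<lambda>T. w T * k T) \<ge> 0"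
    by (intro integral_nonneg integrable_continuous_real cont nonneg)
  moreover have "(LINT T|weight_measure w. k T) = integral {a..b} (\<lambda>T. w T * k T)"
    using weight_measure_integral(3)[OF cont_w pos_w k(1) f'(1) k(2)] by simp
  ultimately show ?thesis by (simp add: L2_norm_def k_def)
qed

theorem corollary2:
  fixes w :: "real \<Rightarrow> real" and \<alpha> :: real
    and V :: "(real \<Rightarrow> complex) \<Rightarrow> (real \<Rightarrow> complex)"
  assumes "zero_density_weight w"
    and "bounded_selfadjoint w V"
  shows "\<not> (\<exists>C::real. \<forall>f\<in>H0_closure_dom w.
              L2_norm w (perturbed_op w \<alpha> V f) \<le> C * L2_norm w f)"
proof
  assume "\<exists>C::real. \<forall>f\<in>H0_closure_dom w. L2_norm w (perturbed_op w \<alpha> V f) \<le> C * L2_norm w f"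
  then obtain C where C: "\<And>f. f \<in> H0_closure_dom w \<Longrightarrow> L2_norm w (perturbed_op w \<alpha> V f) \<le> C * L2_norm w f"
    by blast
  obtain K where K: "\<And>f. f \<in> L2 w \<Longrightarrow> L2_norm w (V f) \<le> K * L2_norm w f"
    and V: "\<And>f. f \<in> L2 w \<Longrightarrow> V f \<in> L2 w"
    using assms(2) unfolding bounded_selfadjoint_def by blast
  \<comment> \<open>The frequency is one more than the bound on the quadratic form that \<open>C\<close> and \<open>V\<close> would impose.\<close>
  define l where "l = C + \<bar>\<alpha>\<bar> * K + 1"
  define f where "f = (\<lambda>T. of_real (bump T) * cis (l * T))"
  define g where "g = H0_closure w f"
  have f: "f \<in> Cc_smooth" unfolding f_def by (rule bump_wave_Cc_smooth)
  have f2: "f \<in> L2 w" by (rule Cc_smooth_L2[OF assms(1) f])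
  have graph: "(f, g) \<in> H0_closure_graph w"
    unfolding g_def H0_closure_def using Cc_smooth_H0_closure_graph[OF assms(1) f]
    by (rule someI[where P = "\<lambda>g. (f, g) \<in> H0_closure_graph w"])
  then have g2: "g \<in> L2 w" by (simp add: H0_closure_graph_def)
  have "f (3/2) \<noteq> 0" by (simp add: f_def bump_eq_0_iff)
  with assms(1) f have pos: "L2_norm w f > 0" by (rule L2_norm_pos)
  let ?h = "perturbed_op w \<alpha> V f"
  have h: "?h = (\<lambda>T. g T + of_real \<alpha> * V f T)" by (simp add: perturbed_op_def g_def)
  have h2: "?h \<in> L2 w" unfolding h by (intro L2_add L2_scale V f2 g2)
  have "L2_inner w ?h f = L2_inner w g f + of_real \<alpha> * L2_inner w (V f) f"
    unfolding h L2_inner_def using L2_inner_integrable[OF g2 f2] L2_inner_integrable[OF V[OF f2] f2]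
    by (simp add: distrib_right mult.assoc)
  then have "L2_inner w g f = L2_inner w ?h f - of_real \<alpha> * L2_inner w (V f) f" by simp
  then have "cmod (L2_inner w g f) \<le> cmod (L2_inner w ?h f) + \<bar>\<alpha>\<bar> * cmod (L2_inner w (V f) f)"
    using norm_triangle_ineq4[of "L2_inner w ?h f" "of_real \<alpha> * L2_inner w (V f) f"]
    by (simp add: norm_mult)
  also have "\<dots> \<le> (C * L2_norm w f) * L2_norm w f + \<bar>\<alpha>\<bar> * ((K * L2_norm w f) * L2_norm w f)"
  proof (intro add_mono mult_left_mono)
    show "cmod (L2_inner w ?h f) \<le> (C * L2_norm w f) * L2_norm w f"
      using L2_Cauchy_Schwarz[OF h2 f2] C[of f] graph pos
      by (smt (verit) DomainI H0_closure_dom_def mult_right_mono)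
    show "cmod (L2_inner w (V f) f) \<le> (K * L2_norm w f) * L2_norm w f"
      using L2_Cauchy_Schwarz[OF V[OF f2] f2] K[OF f2] pos by (smt (verit) mult_right_mono)
  qed simp
  also have "\<dots> = (l - 1) * (L2_norm w f)\<^sup>2"
    by (simp add: l_def power2_eq_square algebra_simps)
  also have "\<dots> < l * (L2_norm w f)\<^sup>2" using pos by simp
  also have "\<dots> = Re (L2_inner w g f)"
    unfolding H0_closure_graph_weak[OF assms(1) graph f]
    unfolding f_def by (rule Re_L2_inner_H0_bump_wave[OF assms(1), symmetric])
  finally show False using complex_Re_le_cmod[of "L2_inner w g f"] by simp
qed

end
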